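(* Let $G$ be a simple connected graph with at least two vertices and let $v_i$ be a vertex of degree $d_i$. Then \[\mathcal{LE}_G(v_i)\geq\frac{1}{d_i}\sum_{w:\,w\sim v_i}\frac{1}{d_w}.\] Equality holds if and only if $G$ is a complete bipartite graph.
   Context: $w\sim v_i$ means $w$ is adjacent to $v_i$, $d_w$ is the degree of $w$. $A$ is the adjacency matrix, $D$ the diagonal degree matrix, $\mathcal{L}=I-D^{-1/2}AD^{-1/2}$ the normalized Laplacian. For a real symmetric matrix $B$, $|B|:=(B^2)^{1/2}$. The normalized Laplacian energy of a vertex is $\mathcal{LE}_G(v_i):=(|\mathcal{L}-I|)_{ii}$.
   Formalization: The equality clause is proved as: equality holds at every vertex if and only if G is complete bipartite. For a single fixed vertex the "only if" is false: the centre of the path on five vertices attains equality (both sides are 1/2), but that path is not complete bipartite. *)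

theory Defs
  imports "HOL-Analysis.Analysis" "Graph_Theory.Graph_Theory"
begin

text \<open>
  A simple graph is a Graph\_Theory \<open>graph\<close>: a finite symmetric digraph without loops and without
  parallel arcs, each edge being a pair of opposite arcs. The neighbours of a vertex are thus
  its out-neighbours, and its degree is \<^const>\<open>out_degree\<close>. The matrices below are indexed by the
  whole vertex type, so they are the matrices of \<open>G\<close> when \<open>verts G = UNIV\<close>.
\<close>

definition adjacency_matrix :: "('v::finite, 'e) pre_digraph \<Rightarrow> real^'v^'v" where
  "adjacency_matrix G = (\<chi> u v. if u \<rightarrow>\<^bsub>G\<^esub> v then 1 else 0)"

text \<open>The matrix $D^{-1/2}$. It is entrywise meaningful only if all degrees are positive;
  on the diagonal, \<open>0 powr (-1/2) = 0\<close>.\<close>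

definition degree_matrix_inv_sqrt :: "('v::finite, 'e) pre_digraph \<Rightarrow> real^'v^'v" where
  "degree_matrix_inv_sqrt G = (\<chi> u v. if u = v then real (out_degree G u) powr (-1/2) else 0)"

definition normalized_laplacian :: "('v::finite, 'e) pre_digraph \<Rightarrow> real^'v^'v" where
  "normalized_laplacian G =
     mat 1 - degree_matrix_inv_sqrt G ** adjacency_matrix G ** degree_matrix_inv_sqrt G"

definition pos_semidef :: "real^'n^'n \<Rightarrow> bool" where
  "pos_semidef S \<longleftrightarrow> transpose S = S \<and> (\<forall>x. 0 \<le> x \<bullet> (S *v x))"

text \<open>The positive semidefinite square root of a positive semidefinite matrix, unspecified for
  other arguments.\<close>

definition matrix_sqrt :: "real^'n^'n \<Rightarrow> real^'n^'n" where
  "matrix_sqrt B = (THE S. pos_semidef S \<and> S ** S = B)"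

definition matrix_abs :: "real^'n^'n \<Rightarrow> real^'n^'n" where
  "matrix_abs B = matrix_sqrt (B ** B)"

definition normalized_laplacian_energy :: "('v::finite, 'e) pre_digraph \<Rightarrow> 'v \<Rightarrow> real" where
  "normalized_laplacian_energy G v = matrix_abs (normalized_laplacian G - mat 1) $ v $ v"

definition complete_bipartite :: "('v, 'e) pre_digraph \<Rightarrow> bool" where
  "complete_bipartite G \<longleftrightarrow> (\<exists>m n. 0 < m \<and> 0 < n \<and> complete_bipartite_digraph m n G)"

end

theory Submission
  imports Defs
begin

text \<open>
  Put \<open>M = D\<^bsup>-1/2\<^esup> A D\<^bsup>-1/2\<^esup>\<close>, so that the energy of \<open>v\<close> is \<open>|M|\<^sub>v\<^sub>v\<close>. Since \<open>M\<close> is a symmetric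
  contraction, \<open>|M| - M\<^sup>2\<close> is positive semidefinite, and its diagonal is the difference of the two
  sides of the inequality. If the diagonal vanishes then \<open>|M| = M\<^sup>2\<close>, hence \<open>M\<^sup>3 = M\<close>. As \<open>M\<close> is
  nonnegative with support \<open>A\<close>, the ends of every walk of length 3 are then adjacent, which for a
  connected loopless graph forces complete bipartiteness. Conversely \<open>M\<^sup>3 = M\<close> for a complete
  bipartite graph, so \<open>M\<^sup>2\<close> is its own positive semidefinite square root.
\<close>

subsection \<open>Positive semidefinite square roots and absolute values of matrices\<close>

text \<open>The discriminant argument: the form at \<open>x + t *\<^sub>R y\<close> is a nonnegative
  quadratic polynomial in \<open>t\<close>. Positivity is asked for on a subspace only, because the
  eigenvector argument below knows no more.\<close>

lemma psd_form_Cauchy_Schwarz: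
  fixes f :: "'a::real_inner \<Rightarrow> 'a"
  assumes "linear f" and "subspace W"
    and sym: "\<And>x y. x \<in> W \<Longrightarrow> y \<in> W \<Longrightarrow> x \<bullet> f y = f x \<bullet> y"
    and psd: "\<And>x. x \<in> W \<Longrightarrow> 0 \<le> x \<bullet> f x"
    and x: "x \<in> W" and y: "y \<in> W"
  shows "(x \<bullet> f y)\<^sup>2 \<le> (x \<bullet> f x) * (y \<bullet> f y)"
proof -
  define a b c where "a = x \<bullet> f x" and "b = x \<bullet> f y" and "c = y \<bullet> f y"
  have c0: "c \<ge> 0" using psd[OF y] by (simp add: c_def)
  have q: "0 \<le> a + 2 * t * b + t\<^sup>2 * c" for t
  proof -
    have "x + t *\<^sub>R y \<in> W"
      using assms(2) x y by (simp add: subspace_add subspace_scale)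
    from psd[OF this] have "0 \<le> (x + t *\<^sub>R y) \<bullet> f (x + t *\<^sub>R y)" .
    also have "\<dots> = a + 2 * t * b + t\<^sup>2 * c"
      using sym[OF x y]
      by (simp add: a_def b_def c_def linear_add[OF assms(1)] linear_scale[OF assms(1)]
          inner_add_left inner_add_right power2_eq_square algebra_simps inner_commute)
    finally show ?thesis .
  qed
  have "b\<^sup>2 \<le> a * c"
  proof (cases "c = 0")
    case True
    have "b = 0"
    proof (rule ccontr)
      assume "b \<noteq> 0"
      \<comment> \<open>This \<open>t\<close> gives the polynomial \<open>a + 2 * t * b\<close> the
        value -1.\<close>
      then show False using q[of "- (a + 1) / (2 * b)"] True by (simp add: field_simps)
    qed
    then show ?thesis using True by simp
  next
    case False
    then have "c > 0" using c0 by simp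
    \<comment> \<open>The quadratic is evaluated at its minimiser \<open>- b / c\<close>.\<close>
    have "0 \<le> c * (a + 2 * (- b / c) * b + (- b / c)\<^sup>2 * c)"
      using q c0 by (rule mult_nonneg_nonneg[rotated])
    also have "\<dots> = a * c - b\<^sup>2"
      using \<open>c > 0\<close> by (simp add: field_simps power2_eq_square)
    finally show ?thesis by simp
  qed
  then show ?thesis by (simp add: a_def b_def c_def)
qed

text \<open>Variational argument: on the compact unit sphere of \<open>W\<close> the form of
  \<open>f\<close> attains its maximum \<open>c\<close> at some \<open>e\<close>. Then
  \<open>h = c - f\<close> is semidefinite on \<open>W\<close> and its form vanishes at
  \<open>e\<close>, which forces \<open>h e = 0\<close>.\<close>

lemma self_adjoint_has_eigenvector:
  fixes f :: "'a::euclidean_space \<Rightarrow> 'a"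
  assumes lin: "linear f" and sym: "\<And>x y. x \<bullet> f y = f x \<bullet> y"
    and W: "subspace W" and inv: "f ` W \<subseteq> W" and ne: "W \<noteq> {0}"
  obtains e c where "e \<in> W" "norm e = 1" "f e = c *\<^sub>R e"
proof -
  define K where "K = W \<inter> sphere 0 1"
  have "compact K"
    unfolding K_def using closed_subspace[OF W] by (intro closed_Int_compact) auto
  moreover have "K \<noteq> {}"
  proof -
    obtain z where z: "z \<in> W" "z \<noteq> 0" using ne subspace_0[OF W] by auto
    then have "z /\<^sub>R norm z \<in> K" using W by (simp add: K_def subspace_scale)
    then show ?thesis by auto
  qed
  moreover have "continuous_on K (\<lambda>x. x \<bullet> f x)"
    by (intro continuous_intros linear_continuous_on lin[unfolded linear_conv_bounded_linear])
  ultimately obtain e where e: "e \<in> K" and max: "\<And>y. y \<in> K \<Longrightarrow> y \<bullet> f y \<le> e \<bullet> f e"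
    using continuous_attains_sup by metis
  define c where "c = e \<bullet> f e"
  define h where "h x = c *\<^sub>R x - f x" for x
  have eW: "e \<in> W" and en: "norm e = 1" using e by (auto simp: K_def)
  have linh: "linear h"
    unfolding h_def by (intro linear_compose_sub lin linear_compose_scale_right linear_ident)
  have hsym: "x \<bullet> h y = h x \<bullet> y" for x y
    using sym[of x y] by (simp add: h_def inner_diff_left inner_diff_right)
  have hpsd: "0 \<le> x \<bullet> h x" if "x \<in> W" for x
  proof (cases "x = 0")
    case False
    then have "x /\<^sub>R norm x \<in> K" using that W by (simp add: K_def subspace_scale)
    from max[OF this] have "(x \<bullet> f x) / (norm x)\<^sup>2 \<le> c"
      by (simp add: c_def linear_scale[OF lin] power2_eq_square field_simps)
    then have "x \<bullet> f x \<le> c * (norm x)\<^sup>2" using False by (simp add: field_simps)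
    then show ?thesis by (simp add: h_def inner_diff_right dot_square_norm)
  qed simp
  have "e \<bullet> e = 1" using en by (simp add: dot_square_norm)
  then have "e \<bullet> h e = 0" by (simp add: h_def inner_diff_right c_def)
  moreover have hW: "h e \<in> W"
    unfolding h_def using W eW inv by (auto intro!: subspace_diff subspace_scale)
  \<comment> \<open>Cauchy-Schwarz for the form of \<open>h\<close> at the pair \<open>h e\<close>,
    \<open>e\<close>; the factor \<open>e \<bullet> h e\<close> on the right is zero.\<close>
  ultimately have "(h e \<bullet> h e)\<^sup>2 \<le> 0"
    using psd_form_Cauchy_Schwarz[OF linh W hsym hpsd hW eW] by simp
  then have "h e = 0" by simp
  then have "f e = c *\<^sub>R e" by (simp add: h_def)
  then show ?thesis using that eW en by blast
qed

text \<open>Induction on the dimension: split off a unit eigenvector \<open>e\<close>.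
  Self-adjointness keeps its orthogonal complement \<open>W'\<close> in \<open>W\<close> invariant,
  and \<open>W'\<close> has smaller dimension.\<close>

lemma self_adjoint_orthonormal_eigenbasis:
  fixes f :: "'a::euclidean_space \<Rightarrow> 'a"
  assumes lin: "linear f" and sym: "\<And>x y. x \<bullet> f y = f x \<bullet> y"
    and "subspace W" and "f ` W \<subseteq> W"
  shows "\<exists>B \<subseteq> W. pairwise orthogonal B \<and> (\<forall>b\<in>B. norm b = 1) \<and> span B = W \<and>
    (\<forall>b\<in>B. \<exists>c. f b = c *\<^sub>R b)"
  using assms(3,4)
proof (induction "dim W" arbitrary: W rule: less_induct)
  case less
  show ?case
  proof (cases "W = {0}")
    case True
    then show ?thesis by (intro exI[of _ "{}"]) auto
  next
    case False
    obtain e c where e: "e \<in> W" "norm e = 1" "f e = c *\<^sub>R e"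
      using self_adjoint_has_eigenvector[OF lin sym less.prems False] by blast
    have ee: "e \<bullet> e = 1" using e(2) by (simp add: dot_square_norm)
    define W' where "W' = W \<inter> {x. e \<bullet> x = 0}"
    have W': "subspace W'"
      unfolding W'_def by (intro subspace_inter less.prems(1) subspace_hyperplane)
    have "e \<notin> W'" using ee by (simp add: W'_def)
    then have "W' \<subset> W" using e(1) unfolding W'_def by blast
    then have "dim W' < dim W"
      using W' less.prems(1) by (metis dim_psubset span_eq_iff)
    moreover have "f ` W' \<subseteq> W'"
    proof (intro subsetI, elim imageE)
      fix y x assume "y = f x" "x \<in> W'"
      then show "y \<in> W'" using less.prems(2) sym[of e x] e(3) by (auto simp: W'_def)
    qed
    ultimately obtain B where B: "B \<subseteq> W'" "pairwise orthogonal B" "\<forall>b\<in>B. norm b = 1"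
      "span B = W'" "\<forall>b\<in>B. \<exists>c. f b = c *\<^sub>R b"
      using less.hyps W' by meson
    have "x \<in> span (insert e B)" if "x \<in> W" for x
    proof -
      have "x - (e \<bullet> x) *\<^sub>R e \<in> W'"
        using that less.prems(1) e(1) ee
        by (auto simp: W'_def inner_diff_right intro!: subspace_diff subspace_scale)
      then show ?thesis using B(4) span_breakdown_eq by blast
    qed
    moreover have "span (insert e B) \<subseteq> W"
      using e(1) B(1) less.prems(1) by (intro span_minimal) (auto simp: W'_def)
    moreover have "pairwise orthogonal (insert e B)"
      using B(1,2) by (auto simp: pairwise_insert W'_def orthogonal_def inner_commute)
    ultimately show ?thesis
      using e B by (intro exI[of _ "insert e B"]) (auto simp: W'_def)
  qed
qed

section \<open>Existence and uniqueness of the semidefinite square root of a square\<close>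

lemma symmetric_matrix_inner:
  fixes A :: "real^'n^'n"
  assumes "transpose A = A"
  shows "x \<bullet> (A *v y) = (A *v x) \<bullet> y"
  by (metis assms dot_lmul_matrix transpose_matrix_vector)

text \<open>Keep an orthonormal eigenbasis of \<open>A\<close> and replace each eigenvalue by its
  absolute value; squaring then forgets the change.\<close>

lemma pos_semidef_exists_sqrt_of_square:
  fixes A :: "real^'n^'n"
  assumes A: "transpose A = A"
  shows "\<exists>S. pos_semidef S \<and> S ** S = A ** A"
proof -
  obtain B where B: "pairwise orthogonal B" "\<forall>b\<in>B. norm b = 1" "span B = (UNIV :: (real^'n) set)"
      "\<forall>b\<in>B. \<exists>c. A *v b = c *\<^sub>R b"
    using self_adjoint_orthonormal_eigenbasis[of "(*v) A" UNIV] symmetric_matrix_inner[OF A]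
    by auto
  from B(4) obtain c where c: "\<And>b. b \<in> B \<Longrightarrow> A *v b = c b *\<^sub>R b" by metis
  have fin: "finite B" using B(1) by (rule pairwise_orthogonal_imp_finite)
  \<comment> \<open>The spectral sum of the orthogonal projections onto the lines of the basis
    vectors, weighted by the absolute eigenvalues.\<close>
  define f where "f x = (\<Sum>b\<in>B. (\<bar>c b\<bar> * (b \<bullet> x)) *\<^sub>R b)" for x
  have lin: "linear f"
    unfolding f_def
    by (intro linearI) (simp_all add: inner_add_right algebra_simps sum.distrib scaleR_sum_right)
  define S where "S = matrix f"
  have Sv: "S *v x = f x" for x unfolding S_def using fun_cong[OF matrix_vector_mul(2)[OF lin]] by simp
  have fb: "f b = \<bar>c b\<bar> *\<^sub>R b" if b: "b \<in> B" for b
  proof -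
    have "f b = (\<Sum>b'\<in>B. if b' = b then \<bar>c b\<bar> *\<^sub>R b else 0)"
      unfolding f_def
    proof (rule sum.cong)
      fix b' assume b': "b' \<in> B"
      show "(\<bar>c b'\<bar> * (b' \<bullet> b)) *\<^sub>R b' = (if b' = b then \<bar>c b\<bar> *\<^sub>R b else 0)"
        using B(1,2) b b' by (auto simp: pairwise_def orthogonal_def dot_square_norm)
    qed simp
    then show ?thesis using fin b by simp
  qed
  have "S *v (S *v x) = A *v (A *v x)" for x
  proof (rule linear_eq_on_span[where f="\<lambda>x. S *v (S *v x)" and B=B])
    show "linear (\<lambda>x. S *v (S *v x))" "linear (\<lambda>x. A *v (A *v x))"
      using linear_compose[OF matrix_vector_mul_linear matrix_vector_mul_linear]
      by (auto simp: o_def)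
    show "x \<in> span B" using B(3) by simp
    show "S *v (S *v b) = A *v (A *v b)" if "b \<in> B" for b
      using that by (simp add: Sv fb c linear_scale[OF lin] matrix_vector_mult_scaleR)
  qed
  then have "S ** S = A ** A"
    by (simp add: matrix_eq matrix_vector_mul_assoc[symmetric])
  moreover have "x \<bullet> (S *v y) = (S *v x) \<bullet> y" for x y
    by (simp add: Sv f_def inner_sum_right inner_sum_left inner_commute mult_ac)
  then have "(transpose S *v x) \<bullet> y = (S *v x) \<bullet> y" for x y
    by (simp add: transpose_matrix_vector dot_lmul_matrix)
  then have "transpose S = S"
    unfolding matrix_eq using vector_eq_rdot by blast
  moreover have "0 \<le> x \<bullet> (S *v x)" for x
    by (auto simp: Sv f_def inner_sum_right inner_commute[of x] mult.assoc intro!: sum_nonneg)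
  ultimately show ?thesis by (auto simp: pos_semidef_def)
qed

text \<open>For an eigenvalue \<open>c\<close> of \<open>D = S - T\<close> with unit eigenvector \<open>b\<close>, the identity \<open>S D + D T = 0\<close>
  gives \<open>c (\<langle>b, S b\<rangle> + \<langle>b, T b\<rangle>) = 0\<close>, whence \<open>c = 0\<close> by positivity of \<open>S\<close> and \<open>T\<close>.\<close>

lemma pos_semidef_sqrt_unique:
  fixes S T :: "real^'n^'n"
  assumes S: "pos_semidef S" and T: "pos_semidef T" and eq: "S ** S = T ** T"
  shows "S = T"
proof -
  define D where "D = S - T"
  have D: "transpose D = D"
    using S T by (simp add: D_def pos_semidef_def transpose_def vec_eq_iff)
  have Dv: "D *v x = S *v x - T *v x" for x
    by (simp add: D_def matrix_vector_mult_diff_rdistrib)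
  obtain B where B: "\<forall>b\<in>B. norm b = 1" "span B = (UNIV :: (real^'n) set)"
      "\<forall>b\<in>B. \<exists>c. D *v b = c *\<^sub>R b"
    using self_adjoint_orthonormal_eigenbasis[of "(*v) D" UNIV] symmetric_matrix_inner[OF D]
    by auto
  have zero: "D *v b = 0" if b: "b \<in> B" for b
  proof -
    obtain c where c: "D *v b = c *\<^sub>R b" using B(3) b by auto
    have "S *v (S *v b) = T *v (T *v b)" by (simp add: matrix_vector_mul_assoc eq)
    then have "S *v (D *v b) + D *v (T *v b) = 0"
      by (simp add: Dv matrix_vector_mult_diff_distrib)
    then have "0 = b \<bullet> (S *v (D *v b)) + b \<bullet> (D *v (T *v b))"
      by (metis inner_add_right inner_zero_right)
    also have "\<dots> = c * (b \<bullet> (S *v b) + b \<bullet> (T *v b))"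
      using c by (simp add: symmetric_matrix_inner[OF D] matrix_vector_mult_scaleR algebra_simps)
    finally have "c = 0 \<or> b \<bullet> (S *v b) + b \<bullet> (T *v b) = 0" by simp
    \<comment> \<open>If the sum of the two nonnegative forms is zero, both vanish, and so does
      their difference \<open>c\<close>.\<close>
    moreover have "b \<bullet> (S *v b) - b \<bullet> (T *v b) = c"
      using arg_cong[OF c, of "\<lambda>y. b \<bullet> y"] b B(1) by (simp add: Dv inner_diff_right dot_square_norm)
    moreover have "0 \<le> b \<bullet> (S *v b)" "0 \<le> b \<bullet> (T *v b)"
      using S T by (auto simp: pos_semidef_def)
    ultimately have "c = 0" by linarith
    then show ?thesis using c by simp
  qed
  have "D *v x = 0" for x
    using linear_eq_on_span[where f="(*v) D" and g="\<lambda>_. 0" and B=B and x=x] zero B(2)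
    by (simp add: linear_zero)
  then show ?thesis by (simp add: matrix_eq Dv)
qed

text \<open>Uniqueness of the root resolves the definite description, so exhibiting one semidefinite
  root suffices.\<close>

lemma matrix_abs_eqI:
  assumes "pos_semidef S" and "S ** S = A ** A"
  shows "matrix_abs A = S"
  unfolding matrix_abs_def matrix_sqrt_def
  using assms by (intro the_equality) (auto intro: pos_semidef_sqrt_unique)

lemma
  fixes A :: "real^'n^'n"
  assumes "transpose A = A"
  shows pos_semidef_matrix_abs: "pos_semidef (matrix_abs A)"
    and matrix_abs_square: "matrix_abs A ** matrix_abs A = A ** A"
proof -
  obtain S where S: "pos_semidef S" "S ** S = A ** A"
    using pos_semidef_exists_sqrt_of_square[OF assms] by blast
  then have "matrix_abs A = S" by (rule matrix_abs_eqI)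
  then show "pos_semidef (matrix_abs A)" "matrix_abs A ** matrix_abs A = A ** A"
    using S by simp_all
qed

section \<open>Diagonals of semidefinite matrices and the comparison of |A| with A^2\<close>

lemma pos_semidef_square:
  fixes A :: "real^'n^'n"
  assumes "transpose A = A"
  shows "pos_semidef (A ** A)"
  using assms symmetric_matrix_inner[OF assms, of x "A *v x" for x]
  by (simp add: pos_semidef_def matrix_transpose_mul matrix_vector_mul_assoc[symmetric])

lemma pos_semidef_Cauchy_Schwarz:
  assumes "pos_semidef S"
  shows "(x \<bullet> (S *v y))\<^sup>2 \<le> (x \<bullet> (S *v x)) * (y \<bullet> (S *v y))"
  using assms symmetric_matrix_inner
  by (intro psd_form_Cauchy_Schwarz[where W=UNIV]) (auto simp: pos_semidef_def)

lemma matrix_entry_eq_inner: "S $ i $ j = axis i 1 \<bullet> (S *v axis j (1::real))"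
  by (simp add: inner_axis_axis inner_axis' matrix_vector_mul_component inner_axis)

lemma pos_semidef_diagonal_nonneg: "pos_semidef S \<Longrightarrow> 0 \<le> S $ i $ i"
  by (simp add: matrix_entry_eq_inner pos_semidef_def)

text \<open>Cauchy-Schwarz at unit vectors bounds the square of the entry at \<open>i\<close>,
  \<open>j\<close> by the product of two diagonal entries. This turns equality at all vertices into
  a matrix identity.\<close>

lemma pos_semidef_zero_diagonal:
  fixes S :: "real^'n^'n"
  assumes "pos_semidef S" and "\<And>i. S $ i $ i = 0"
  shows "S = 0"
proof -
  have "S $ i $ j = 0" for i j
    using pos_semidef_Cauchy_Schwarz[OF assms(1), of "axis i 1" "axis j 1"] assms(2)
    by (simp add: matrix_entry_eq_inner[symmetric])
  then show ?thesis by (simp add: vec_eq_iff)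
qed

text \<open>Stands in for the eigenvalue inequality \<open>\<bar>\<lambda>\<bar> \<ge> \<lambda>\<^sup>2\<close> when \<open>\<bar>\<lambda>\<bar> \<le> 1\<close>.\<close>

lemma matrix_abs_minus_square_pos_semidef:
  fixes A :: "real^'n^'n"
  assumes A: "transpose A = A" and contr: "\<And>x. norm (A *v x) \<le> norm x"
  shows "pos_semidef (matrix_abs A - A ** A)"
proof -
  define S where "S = matrix_abs A"
  have S: "pos_semidef S" "transpose S = S" and SS: "S ** S = A ** A"
    using pos_semidef_matrix_abs[OF A] matrix_abs_square[OF A]
    by (simp_all add: S_def pos_semidef_def)
  have sq: "x \<bullet> (A ** A *v x) = (norm (S *v x))\<^sup>2" for x
    by (simp add: SS[symmetric] matrix_vector_mul_assoc[symmetric]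
        symmetric_matrix_inner[OF S(2)] dot_square_norm)
  \<comment> \<open>Since \<open>S\<close> and \<open>A\<close> have the same square, they stretch
    each vector equally, so \<open>S\<close> inherits the contraction property.\<close>
  have "(norm (S *v x))\<^sup>2 = (norm (A *v x))\<^sup>2" for x
    unfolding sq[symmetric]
    by (simp add: matrix_vector_mul_assoc[symmetric] symmetric_matrix_inner[OF A] dot_square_norm)
  then have Scontr: "norm (S *v x) \<le> norm x" for x
    using contr[of x] by simp
  have "(norm (S *v x))\<^sup>2 \<le> x \<bullet> (S *v x)" for x
  proof -
    let ?y = "S *v x"
    have xx: "0 \<le> x \<bullet> (S *v x)" using S by (simp add: pos_semidef_def)
    have "?y \<bullet> (S *v ?y) \<le> norm ?y * norm (S *v ?y)" by (rule norm_cauchy_schwarz)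
    also have "\<dots> \<le> norm ?y * norm ?y" by (intro mult_left_mono Scontr) simp
    finally have *: "?y \<bullet> (S *v ?y) \<le> (norm ?y)\<^sup>2" by (simp add: power2_eq_square)
    \<comment> \<open>Cauchy-Schwarz for the form of \<open>S\<close> at \<open>x\<close> and
      \<open>?y\<close>, combined with \<open>*\<close>, leaves a common factor
      \<open>(norm ?y)\<^sup>2\<close> to cancel.\<close>
    have "(norm ?y)\<^sup>2 * (norm ?y)\<^sup>2 = (x \<bullet> (S *v ?y))\<^sup>2"
      by (simp add: symmetric_matrix_inner[OF S(2)] dot_square_norm power2_eq_square)
    also have "\<dots> \<le> (x \<bullet> (S *v x)) * (?y \<bullet> (S *v ?y))" by (rule pos_semidef_Cauchy_Schwarz[OF S(1)])
    also have "\<dots> \<le> (x \<bullet> (S *v x)) * (norm ?y)\<^sup>2" by (intro mult_left_mono * xx)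
    finally show ?thesis
      using xx mult_right_le_imp_le[of "(norm ?y)\<^sup>2" "(norm ?y)\<^sup>2"] by (cases "?y = 0") simp_all
  qed
  then have "0 \<le> x \<bullet> ((S - A ** A) *v x)" for x
    by (simp add: matrix_vector_mult_diff_rdistrib inner_diff_right sq)
  moreover have "transpose (S - A ** A) = S - A ** A"
    using S(2) pos_semidef_square[OF A] by (simp add: pos_semidef_def transpose_def vec_eq_iff)
  ultimately show ?thesis by (simp add: pos_semidef_def S_def)
qed

text \<open>The vector \<open>?z\<close> lies in the range of \<open>A\<close> and, by the
  hypothesis, in its kernel. For symmetric \<open>A\<close> these are orthogonal, so
  \<open>?z\<close> is orthogonal to itself.\<close>

lemma matrix_power3_eq_self_of_power4:
  fixes A :: "real^'n^'n"
  assumes A: "transpose A = A" and A4: "(A ** A) ** (A ** A) = A ** A"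
  shows "A ** (A ** A) = A"
proof -
  have A4': "A *v (A *v (A *v (A *v x))) = A *v (A *v x)" for x
    using A4 by (metis matrix_vector_mul_assoc)
  have "A *v (A *v (A *v x)) = A *v x" for x
  proof -
    let ?z = "A *v (A *v (A *v x)) - A *v x"
    have "A *v ?z = 0"
      by (simp add: matrix_vector_mult_diff_distrib A4')
    moreover have "?z = A *v (A *v (A *v x) - x)"
      by (simp add: matrix_vector_mult_diff_distrib)
    ultimately have "?z \<bullet> ?z = 0"
      by (metis symmetric_matrix_inner[OF A] inner_zero_left inner_commute)
    then show ?thesis by simp
  qed
  then show ?thesis by (simp add: matrix_eq matrix_vector_mul_assoc[symmetric])
qed

subsection \<open>Graphs and their normalized adjacency matrices\<close>

lemma (in graph) dominates_commute: "u \<rightarrow>\<^bsub>G\<^esub> v \<longleftrightarrow> v \<rightarrow>\<^bsub>G\<^esub> u"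
  using sym_arcs by (auto simp: symmetric_def elim: symE)

lemma (in nomulti_digraph) out_degree_eq_card_dominated: "out_degree G v = card {w. v \<rightarrow>\<^bsub>G\<^esub> w}"
proof -
  have "inj_on (head G) (out_arcs G v)"
    by (rule inj_onI) (simp add: no_multi_arcs arc_to_ends_def)
  moreover have "head G ` out_arcs G v = {w. v \<rightarrow>\<^bsub>G\<^esub> w}"
    by (auto simp: arcs_ends_conv)
  ultimately show ?thesis unfolding out_degree_def by (metis card_image)
qed

text \<open>Connectedness is defined through the symmetric closure, which has the same reachability
  because the arcs are already symmetric.\<close>

lemma (in graph) connected_imp_reachable:
  assumes "Digraph_Component.connected G" "u \<in> verts G" "v \<in> verts G"
  shows "u \<rightarrow>\<^sup>*\<^bsub>G\<^esub> v"
proof -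
  have "strongly_connected (mk_symmetric G)" using assms(1) by (simp add: connected_def)
  then have "u \<rightarrow>\<^sup>*\<^bsub>mk_symmetric G\<^esub> v" using assms(2,3) by (auto simp: strongly_connected_def)
  then show ?thesis using reachable_mk_symmetric_eq[OF sym_arcs] by simp
qed

text \<open>A walk to a second vertex has a first arc.\<close>

lemma (in graph) connected_imp_out_degree_pos:
  assumes "Digraph_Component.connected G" "card (verts G) \<ge> 2" "u \<in> verts G"
  shows "0 < out_degree G u"
proof -
  have "verts G \<noteq> {u}" using assms(2) by auto
  then obtain v where v: "v \<in> verts G" "v \<noteq> u" using assms(3) by auto
  have "u \<rightarrow>\<^sup>*\<^bsub>G\<^esub> v" by (rule connected_imp_reachable) (use assms v in auto)
  then obtain w where "u \<rightarrow>\<^bsub>G\<^esub> w" using v(2) by (auto elim: converse_reachable_cases)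
  then show ?thesis
    unfolding out_degree_def by (auto simp: card_gt_0_iff elim!: reachableE)
qed

text \<open>If walks of length 3 can be shortcut to arcs, then the parts are the neighbourhood of any
  vertex and its complement.\<close>

lemma (in graph) complete_bipartite_of_walk3_shortcut:
  assumes conn: "Digraph_Component.connected G" and two: "card (verts G) \<ge> 2"
    and short: "\<And>a b c d. a \<rightarrow>\<^bsub>G\<^esub> b \<Longrightarrow> b \<rightarrow>\<^bsub>G\<^esub> c \<Longrightarrow> c \<rightarrow>\<^bsub>G\<^esub> d \<Longrightarrow> a \<rightarrow>\<^bsub>G\<^esub> d"
  shows "complete_bipartite G"
proof -
  have irrefl: "\<not> a \<rightarrow>\<^bsub>G\<^esub> a" for a using adj_not_same by blast
  have comm: "a \<rightarrow>\<^bsub>G\<^esub> b \<Longrightarrow> b \<rightarrow>\<^bsub>G\<^esub> a" for a b using dominates_commute by blast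
  obtain v where v: "v \<in> verts G" using two by fastforce
  define V where "V = {w. v \<rightarrow>\<^bsub>G\<^esub> w}"
  define U where "U = verts G - V"
  have Vsub: "V \<subseteq> verts G" using adj_in_verts by (auto simp: V_def)
  have fin: "finite U" "finite V" using finite_subset[OF Vsub] by (simp_all add: U_def)
  have "V \<noteq> {}"
    using connected_imp_out_degree_pos[OF conn two v]
    by (simp add: V_def out_degree_eq_card_dominated card_gt_0_iff)
  then obtain w where w: "v \<rightarrow>\<^bsub>G\<^esub> w" by (auto simp: V_def)
  \<comment> \<open>Every vertex is within two steps of \<open>v\<close>: \<open>v\<close> itself by
    going to \<open>w\<close> and back, and a walk that grows to length 3 is shortcut to an
    arc.\<close>
  have dist2: "v \<rightarrow>\<^bsub>G\<^esub> u \<or> (\<exists>b. v \<rightarrow>\<^bsub>G\<^esub> b \<and> b \<rightarrow>\<^bsub>G\<^esub> u)" if "u \<in> verts G" for u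
  proof -
    have "v \<rightarrow>\<^sup>*\<^bsub>G\<^esub> u" by (rule connected_imp_reachable[OF conn v that])
    then show ?thesis
    proof (induction rule: reachable_induct)
      case base
      then show ?case using w comm by blast
    next
      case (step x y)
      then show ?case using short by blast
    qed
  qed
  \<comment> \<open>From \<open>a\<close> there is a path through some \<open>c\<close> to
    \<open>v\<close> and on to \<open>b\<close>, a walk of length 3.\<close>
  have UV: "a \<rightarrow>\<^bsub>G\<^esub> b" if ab: "a \<in> U" "b \<in> V" for a b
  proof -
    obtain c where "v \<rightarrow>\<^bsub>G\<^esub> c" "c \<rightarrow>\<^bsub>G\<^esub> a" using dist2[of a] ab by (auto simp: U_def V_def)
    then show ?thesis using short[of a c v b] comm ab by (auto simp: V_def)
  qed
  \<comment> \<open>An arc inside \<open>V\<close> closes a triangle through \<open>v\<close>, and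
    one inside \<open>U\<close> a triangle through \<open>w\<close>; the shortcut would make a loop
    of it.\<close>
  have VV: "\<not> a \<rightarrow>\<^bsub>G\<^esub> b" if "a \<in> V" "b \<in> V" for a b
    using short[of v a b v] comm irrefl that by (auto simp: V_def)
  have UU: "\<not> a \<rightarrow>\<^bsub>G\<^esub> b" if "a \<in> U" "b \<in> U" for a b
    using short[of w a b w] UV[of _ w] comm irrefl w that by (auto simp: V_def)
  have "arcs_ends G = U \<times> V \<union> V \<times> U"
  proof (intro set_eqI, clarify)
    fix a b
    have "a \<rightarrow>\<^bsub>G\<^esub> b \<Longrightarrow> a \<in> verts G \<and> b \<in> verts G" using adj_in_verts by blast
    then show "a \<rightarrow>\<^bsub>G\<^esub> b \<longleftrightarrow> (a, b) \<in> U \<times> V \<union> V \<times> U"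
      using UV VV UU comm unfolding U_def by blast
  qed
  moreover have "v \<in> U" using v irrefl by (auto simp: U_def V_def)
  moreover have "verts G = U \<union> V" "U \<inter> V = {}" using Vsub by (auto simp: U_def)
  ultimately show ?thesis
    using fin \<open>V \<noteq> {}\<close> graph_axioms
    unfolding complete_bipartite_def complete_bipartite_digraph_def
    by (intro exI[of _ "card U"] exI[of _ "card V"]) (auto simp: card_gt_0_iff)
qed

section \<open>The normalized adjacency matrix: its entries, its square and its norm\<close>

text \<open>Closed entrywise form of the product subtracted in \<open>normalized_laplacian\<close>,
  from which sign and support of the entries can be read off.\<close>

definition normalized_adjacency :: "('v::finite, 'e) pre_digraph \<Rightarrow> real^'v^'v" where
  "normalized_adjacency G =
     (\<chi> u v. if u \<rightarrow>\<^bsub>G\<^esub> v then 1 / (sqrt (real (out_degree G u)) * sqrt (real (out_degree G v))) else 0)"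

lemma normalized_laplacian_eq:
  "normalized_laplacian G - mat 1 = - normalized_adjacency G"
proof -
  let ?s = "\<lambda>u. real (out_degree G u) powr (-1/2)"
  \<comment> \<open>At degree 0 both sides take the default value 0.\<close>
  have s: "?s u = 1 / sqrt (real (out_degree G u))" for u
    by (simp add: powr_minus powr_half_sqrt divide_simps)
  have left: "(degree_matrix_inv_sqrt G ** B) $ u $ v = ?s u * B $ u $ v"
    and right: "(B ** degree_matrix_inv_sqrt G) $ u $ v = B $ u $ v * ?s v" for B u v
    by (simp_all add: matrix_matrix_mult_def degree_matrix_inv_sqrt_def
        if_distrib[of "\<lambda>x. x * _"] if_distrib[of "\<lambda>x. _ * x"] cong: if_cong)
  have "(degree_matrix_inv_sqrt G ** adjacency_matrix G ** degree_matrix_inv_sqrt G) $ u $ v =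
      normalized_adjacency G $ u $ v" for u v
    unfolding right left s by (simp add: adjacency_matrix_def normalized_adjacency_def)
  then have "degree_matrix_inv_sqrt G ** adjacency_matrix G ** degree_matrix_inv_sqrt G =
      normalized_adjacency G"
    by (simp add: vec_eq_iff)
  then show ?thesis by (simp add: normalized_laplacian_def)
qed


lemma transpose_normalized_adjacency:
  assumes "graph G"
  shows "transpose (normalized_adjacency G) = normalized_adjacency G"
  using graph.dominates_commute[OF assms]
  by (auto simp: normalized_adjacency_def transpose_def vec_eq_iff)

text \<open>By symmetry the diagonal of the square sums squared entries, which removes the roots;
  the result is the bound of the theorem.\<close>

lemma normalized_adjacency_square_diagonal:
  assumes "graph G"
  shows "(normalized_adjacency G ** normalized_adjacency G) $ v $ v =
    1 / real (out_degree G v) * (\<Sum>w | v \<rightarrow>\<^bsub>G\<^esub> w. 1 / real (out_degree G w))"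
proof -
  have "(normalized_adjacency G ** normalized_adjacency G) $ v $ v =
      (\<Sum>w\<in>UNIV. if v \<rightarrow>\<^bsub>G\<^esub> w then 1 / real (out_degree G v) * (1 / real (out_degree G w)) else 0)"
    using graph.dominates_commute[OF assms]
    by (auto simp: matrix_matrix_mult_def normalized_adjacency_def real_sqrt_mult[symmetric]
        mult.commute[of "real (out_degree G v)"] intro!: sum.cong)
  then show ?thesis by (simp add: sum.If_cases sum_distrib_left)
qed

text \<open>Cauchy-Schwarz in each row, splitting the entry into its two root factors, bounds the
  squared coordinate by a sum over neighbours. Summing over all rows counts each
  \<open>(x $ w)\<^sup>2 / ?d w\<close> once per neighbour of \<open>w\<close>, hence
  \<open>?d w\<close> times.\<close>

lemma norm_normalized_adjacency_le:
  assumes "graph G"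
  shows "norm (normalized_adjacency G *v x) \<le> norm x"
proof -
  interpret graph G by fact
  let ?d = "\<lambda>u. real (out_degree G u)"
  have d: "(\<Sum>w | u \<rightarrow>\<^bsub>G\<^esub> w. c) = ?d u * c" for u c
    by (simp add: out_degree_eq_card_dominated)
  have row: "((normalized_adjacency G *v x) $ u)\<^sup>2 \<le> (\<Sum>w | u \<rightarrow>\<^bsub>G\<^esub> w. (x $ w)\<^sup>2 / ?d w)" for u
  proof -
    have "(normalized_adjacency G *v x) $ u =
        (\<Sum>w\<in>UNIV. if u \<rightarrow>\<^bsub>G\<^esub> w then 1 / sqrt (?d u) * (x $ w / sqrt (?d w)) else 0)"
      by (auto simp: matrix_vector_mult_def normalized_adjacency_def intro!: sum.cong)
    also have "\<dots> = (\<Sum>w | u \<rightarrow>\<^bsub>G\<^esub> w. 1 / sqrt (?d u) * (x $ w / sqrt (?d w)))"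
      by (simp add: sum.If_cases)
    finally have "((normalized_adjacency G *v x) $ u)\<^sup>2 \<le>
        (\<Sum>w | u \<rightarrow>\<^bsub>G\<^esub> w. (1 / sqrt (?d u))\<^sup>2) * (\<Sum>w | u \<rightarrow>\<^bsub>G\<^esub> w. (x $ w / sqrt (?d w))\<^sup>2)"
      by (simp only: Cauchy_Schwarz_ineq_sum)
    also have "\<dots> = (?d u * (1 / ?d u)) * (\<Sum>w | u \<rightarrow>\<^bsub>G\<^esub> w. (x $ w)\<^sup>2 / ?d w)"
      unfolding d by (simp add: power_divide)
    \<comment> \<open>The factor \<open>?d u * (1 / ?d u)\<close> is 1, or 0 at an isolated
      vertex.\<close>
    also have "\<dots> \<le> 1 * (\<Sum>w | u \<rightarrow>\<^bsub>G\<^esub> w. (x $ w)\<^sup>2 / ?d w)"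
      by (intro mult_right_mono sum_nonneg) auto
    finally show ?thesis by simp
  qed
  have norm2: "(norm y)\<^sup>2 = (\<Sum>u\<in>UNIV. (y $ u)\<^sup>2)" for y :: "real^'a"
    by (simp add: dot_square_norm[symmetric] inner_vec_def power2_eq_square[of "y $ _"])
  have "(norm (normalized_adjacency G *v x))\<^sup>2 \<le> (\<Sum>u\<in>UNIV. \<Sum>w | u \<rightarrow>\<^bsub>G\<^esub> w. (x $ w)\<^sup>2 / ?d w)"
    unfolding norm2 by (intro sum_mono row)
  also have "\<dots> = (\<Sum>u\<in>UNIV. \<Sum>w\<in>UNIV. if u \<rightarrow>\<^bsub>G\<^esub> w then (x $ w)\<^sup>2 / ?d w else 0)"
    by (simp add: sum.If_cases)
  also have "\<dots> = (\<Sum>w\<in>UNIV. \<Sum>u\<in>UNIV. if w \<rightarrow>\<^bsub>G\<^esub> u then (x $ w)\<^sup>2 / ?d w else 0)"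
    by (subst sum.swap) (simp only: dominates_commute)
  also have "\<dots> = (\<Sum>w\<in>UNIV. ?d w * ((x $ w)\<^sup>2 / ?d w))"
    by (simp add: sum.If_cases out_degree_eq_card_dominated)
  also have "\<dots> \<le> (norm x)\<^sup>2"
    unfolding norm2 by (intro sum_mono) auto
  finally show ?thesis by simp
qed

section \<open>The equation M^3 = M and its meaning for the graph\<close>

text \<open>All entries are nonnegative, so the walk alone contributes a positive term to the entry
  of the cube at \<open>a\<close>, \<open>d\<close>; no other term can cancel it.\<close>

lemma dominates_of_normalized_adjacency_power3:
  assumes M3: "normalized_adjacency G ** (normalized_adjacency G ** normalized_adjacency G) =
      normalized_adjacency G"
    and pos: "\<And>u. 0 < out_degree G u"
    and walk: "a \<rightarrow>\<^bsub>G\<^esub> b" "b \<rightarrow>\<^bsub>G\<^esub> c" "c \<rightarrow>\<^bsub>G\<^esub> d"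
  shows "a \<rightarrow>\<^bsub>G\<^esub> d"
proof -
  let ?M = "normalized_adjacency G"
  have M0: "0 \<le> ?M $ u $ w" for u w by (simp add: normalized_adjacency_def)
  have M1: "0 < ?M $ u $ w" if "u \<rightarrow>\<^bsub>G\<^esub> w" for u w
    using pos that by (simp add: normalized_adjacency_def)
  have MM0: "0 \<le> (?M ** ?M) $ u $ w" for u w
    using M0 by (simp add: matrix_matrix_mult_def sum_nonneg)
  have "0 < ?M $ b $ c * ?M $ c $ d" using M1 walk by simp
  also have "\<dots> \<le> (?M ** ?M) $ b $ d"
    using M0 by (simp add: matrix_matrix_mult_def
        member_le_sum[of c UNIV "\<lambda>k. ?M $ b $ k * ?M $ k $ d"])
  finally have "0 < ?M $ a $ b * (?M ** ?M) $ b $ d" using M1 walk by simp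
  also have "\<dots> \<le> (?M ** (?M ** ?M)) $ a $ d"
    unfolding matrix_matrix_mult_def[of ?M "?M ** ?M"] using M0 MM0
    by (simp add: member_le_sum[of b UNIV "\<lambda>k. ?M $ a $ k * (?M ** ?M) $ k $ d"])
  finally have "0 < ?M $ a $ d" unfolding M3 .
  then show ?thesis by (simp add: normalized_adjacency_def split: if_splits)
qed

text \<open>The matrix is constant \<open>r\<close> between the parts and 0 within them. A third
  power multiplies the off-diagonal blocks by \<open>card U * card V * r^2\<close>, which is
  1.\<close>

lemma complete_bipartite_normalized_adjacency_power3:
  fixes G :: "('v::finite, 'e) pre_digraph"
  assumes "complete_bipartite G" and verts: "verts G = UNIV"
  shows "normalized_adjacency G ** (normalized_adjacency G ** normalized_adjacency G) =
      normalized_adjacency G"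
proof -
  obtain U V where "graph G" and UV: "U \<union> V = UNIV" "U \<inter> V = {}" and
    pos: "0 < card U" "0 < card V" and arcs: "arcs_ends G = U \<times> V \<union> V \<times> U"
    using assms unfolding complete_bipartite_def complete_bipartite_digraph_def by metis
  interpret graph G by fact
  have V: "V = - U" using UV by auto
  define r where "r = 1 / (sqrt (real (card U)) * sqrt (real (card V)))"
  have r2: "real (card U) * real (card V) * (r * r) = 1"
    using pos by (auto simp: r_def real_sqrt_mult[symmetric] card_gt_0_iff)
  have deg: "out_degree G u = (if u \<in> U then card V else card U)" for u
    using UV by (auto simp: out_degree_eq_card_dominated arcs intro!: arg_cong[where f=card])
  have M: "normalized_adjacency G $ u $ w = (if u \<in> U \<longleftrightarrow> w \<in> U then 0 else r)" for u w
    by (auto simp: normalized_adjacency_def arcs deg V r_def mult.commute)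
  have MM: "(normalized_adjacency G ** normalized_adjacency G) $ u $ w =
      (if u \<in> U \<longleftrightarrow> w \<in> U then (if u \<in> U then card V else card U) * (r * r) else 0)" for u w
  proof -
    \<comment> \<open>Only those \<open>k\<close> in the part opposite to \<open>u\<close>
      contribute, and then only if \<open>w\<close> is on the side of \<open>u\<close>.\<close>
    have "(normalized_adjacency G ** normalized_adjacency G) $ u $ w =
        (\<Sum>k\<in>UNIV. if k \<in> (if u \<in> U then V else U) then (if u \<in> U \<longleftrightarrow> w \<in> U then r * r else 0) else 0)"
      by (auto simp: matrix_matrix_mult_def M V intro!: sum.cong sum.neutral)
    then show ?thesis by (simp add: sum.If_cases)
  qed
  have "(normalized_adjacency G ** (normalized_adjacency G ** normalized_adjacency G)) $ u $ w =
      normalized_adjacency G $ u $ w" for u w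
  proof -
    have "(normalized_adjacency G ** (normalized_adjacency G ** normalized_adjacency G)) $ u $ w =
        (\<Sum>k\<in>UNIV. if k \<in> (if u \<in> U then V else U)
          then (if u \<in> U \<longleftrightarrow> w \<in> U then 0 else r * ((if u \<in> U then card U else card V) * (r * r))) else 0)"
      unfolding matrix_matrix_mult_def[of _ "_ ** _"] by (auto simp: MM M V intro!: sum.cong sum.neutral)
    also have "\<dots> = normalized_adjacency G $ u $ w"
      using r2 by (auto simp: sum.If_cases M algebra_simps)
    finally show ?thesis .
  qed
  then show ?thesis by (simp add: vec_eq_iff)
qed

section \<open>The energy bound and its equality case\<close>

theorem theorem4p4:
  fixes G :: "('v::finite, 'e) pre_digraph"
  assumes "graph G"
    and "Digraph_Component.connected G"
    and "verts G = UNIV"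
    and "card (verts G) \<ge> 2"
  shows "(\<forall>v \<in> verts G. normalized_laplacian_energy G v \<ge>
            1 / real (out_degree G v) * (\<Sum>w | v \<rightarrow>\<^bsub>G\<^esub> w. 1 / real (out_degree G w))) \<and>
         ((\<forall>v \<in> verts G. normalized_laplacian_energy G v =
            1 / real (out_degree G v) * (\<Sum>w | v \<rightarrow>\<^bsub>G\<^esub> w. 1 / real (out_degree G w))) \<longleftrightarrow>
          complete_bipartite G)"
proof -
  interpret graph G by fact
  let ?M = "normalized_adjacency G"
  let ?N = "matrix_abs ?M - ?M ** ?M"
  let ?bound = "\<lambda>v. 1 / real (out_degree G v) * (\<Sum>w | v \<rightarrow>\<^bsub>G\<^esub> w. 1 / real (out_degree G w))"
  have M: "transpose ?M = ?M" by (rule transpose_normalized_adjacency[OF assms(1)])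
  \<comment> \<open>The absolute value depends only on the square, so the sign in
    \<open>normalized_laplacian_eq\<close> disappears.\<close>
  have "(- ?M) ** (- ?M) = ?M ** ?M" by (simp add: matrix_matrix_mult_def)
  then have "matrix_abs (normalized_laplacian G - mat 1) = matrix_abs ?M"
    unfolding normalized_laplacian_eq matrix_abs_def by simp
  then have N: "?N $ v $ v = normalized_laplacian_energy G v - ?bound v" for v
    by (simp add: normalized_laplacian_energy_def normalized_adjacency_square_diagonal[OF assms(1)])
  have psd: "pos_semidef ?N"
    by (rule matrix_abs_minus_square_pos_semidef[OF M norm_normalized_adjacency_le[OF assms(1)]])
  have "(\<forall>v \<in> verts G. normalized_laplacian_energy G v = ?bound v) \<longleftrightarrow> complete_bipartite G"
  proof
    assume "\<forall>v \<in> verts G. normalized_laplacian_energy G v = ?bound v"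
    then have "?N $ v $ v = 0" for v unfolding N using assms(3) by simp
    then have "?N = 0" by (rule pos_semidef_zero_diagonal[OF psd])
    then have "matrix_abs ?M = ?M ** ?M" by simp
    \<comment> \<open>Squaring |M| = M^2 and using |M|^2 = M^2 gives M^4 = M^2.\<close>
    then have "(?M ** ?M) ** (?M ** ?M) = ?M ** ?M" using matrix_abs_square[OF M] by simp
    then have M3: "?M ** (?M ** ?M) = ?M" by (rule matrix_power3_eq_self_of_power4[OF M])
    have "0 < out_degree G u" for u
      using connected_imp_out_degree_pos[OF assms(2,4)] assms(3) by simp
    then show "complete_bipartite G"
      using complete_bipartite_of_walk3_shortcut[OF assms(2,4)]
        dominates_of_normalized_adjacency_power3[OF M3] by blast
  next
    assume "complete_bipartite G"
    then have "?M ** (?M ** ?M) = ?M"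
      using assms(3) by (rule complete_bipartite_normalized_adjacency_power3)
    then have "(?M ** ?M) ** (?M ** ?M) = ?M ** ?M"
      by (simp add: matrix_mul_assoc[symmetric])
    then have "matrix_abs ?M = ?M ** ?M"
      by (rule matrix_abs_eqI[OF pos_semidef_square[OF M]])
    then show "\<forall>v \<in> verts G. normalized_laplacian_energy G v = ?bound v"
      using N by simp
  qed
  moreover have "?bound v \<le> normalized_laplacian_energy G v" for v
    using pos_semidef_diagonal_nonneg[OF psd, of v] unfolding N by simp
  ultimately show ?thesis by blast
qed

end
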